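(* Let $A_k(x)=\frac{1}{2}(\mathcal{D}_{12\ldots k}(x)+\mathcal{D}_{12\ldots k}(-x))$ and $B_k(x)=\frac{1}{2}(\mathcal{D}_{12\ldots k}(x)-\mathcal{D}_{12\ldots k}(-x))$ for all $k\geq 0$. Then $$A_k(x)=F_k(x),\qquad B_k(x)=xF_{k-1}(x), \quad \mbox{and}\quad \mathcal{D}_{12\dots k}(x)=F_k(x)+xF_{k-1}(x).$$
   Context: A permutation $\pi$ is a Dumont permutation (of the first kind) if each even integer in $\pi$ is followed by a smaller integer, and each odd integer is either followed by a larger integer or is the last element of $\pi$. A permutation avoids a pattern $\tau$ if it has no subsequence order-isomorphic to $\tau$. For a pattern $\tau$, let $\mathcal{D}_\tau(n)$ be the number of Dumont permutations of length $n$ that avoid both $132$ and $\tau$, and $\mathcal{D}_\tau(x)=\sum_{n\geq0}\mathcal{D}_\tau(n)x^n$. For $r\geq2$ consider the recurrence $Q_r(x)=1+\frac{x^2Q_{r-1}(x)}{1-x^2Q_{r-2}(x)}$; $F_r(x)$ denotes its solution with $Q_0(x)=0$, $Q_1(x)=1$ (so e.g. $F_2=1+x^2$, $F_3=\frac{1+x^4}{1-x^2}$). *)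

theory Defs
  imports
    "HOL-Computational_Algebra.Formal_Power_Series"
    "HOL-Combinatorics.Multiset_Permutations"
    "HOL-Library.Sublist"
begin

definition dumont :: "nat list \<Rightarrow> bool" where
  "dumont p \<longleftrightarrow> (\<forall>i < length p.
     (even (p ! i) \<longrightarrow> Suc i < length p \<and> p ! Suc i < p ! i) \<and>
     (odd (p ! i) \<longrightarrow> Suc i = length p \<or> p ! i < p ! Suc i))"

definition order_isomorphic :: "nat list \<Rightarrow> nat list \<Rightarrow> bool" where
  "order_isomorphic s t \<longleftrightarrow> length s = length t \<and>
     (\<forall>i < length s. \<forall>j < length s. s ! i < s ! j \<longleftrightarrow> t ! i < t ! j)"

definition avoids :: "nat list \<Rightarrow> nat list \<Rightarrow> bool" where
  "avoids p t \<longleftrightarrow> \<not> (\<exists>s. subseq s p \<and> order_isomorphic s t)"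

definition dumont_avoiders :: "nat list \<Rightarrow> nat \<Rightarrow> nat list set" where
  "dumont_avoiders t n =
     {p \<in> permutations_of_set {1..n}. dumont p \<and> avoids p [1, 3, 2] \<and> avoids p t}"

definition dumont_gf :: "nat list \<Rightarrow> rat fps" where
  "dumont_gf t = Abs_fps (\<lambda>n. of_nat (card (dumont_avoiders t n)))"

text \<open>The pattern \<open>12\<dots>k\<close>; for \<open>k = 0\<close> it is empty, hence contained in every permutation.\<close>
definition increasing_pattern :: "nat \<Rightarrow> nat list" where
  "increasing_pattern k = [1..<Suc k]"

definition A :: "nat \<Rightarrow> rat fps" where
  "A k = fps_const (1/2) *
     (dumont_gf (increasing_pattern k) + (dumont_gf (increasing_pattern k) oo - fps_X))"

definition B :: "nat \<Rightarrow> rat fps" where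
  "B k = fps_const (1/2) *
     (dumont_gf (increasing_pattern k) - (dumont_gf (increasing_pattern k) oo - fps_X))"

text \<open>The denominators have constant coefficient \<open>1\<close>, so the division is by a unit.\<close>
fun F_nat :: "nat \<Rightarrow> rat fps" where
  "F_nat 0 = 0"
| "F_nat (Suc 0) = 1"
| "F_nat (Suc (Suc r)) = 1 + fps_X\<^sup>2 * F_nat (Suc r) / (1 - fps_X\<^sup>2 * F_nat r)"

text \<open>Integer index, so that \<open>F (k - 1)\<close> makes sense for \<open>k = 0\<close>; the recurrence
  does not determine \<open>F (-1)\<close>, and the convention is \<open>F (-1) = 0\<close>.\<close>
definition F :: "int \<Rightarrow> rat fps" where
  "F r = (if r < 0 then 0 else F_nat (nat r))"

end

theory Submission
  imports Defs
begin

text \<open>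
  In a 132-avoiding permutation \<open>L n R\<close> of \<open>{1..n}\<close> every entry of \<open>L\<close> exceeds every entry of
  \<open>R\<close>, so an increasing subsequence lies in \<open>L n\<close> or in \<open>R\<close>.  If \<open>n\<close> is odd, the Dumont condition
  forces \<open>R\<close> to be empty, whence \<open>B\<^sub>k = x A\<^sub>k\<^sub>-\<^sub>1\<close>.  If \<open>n\<close> is even, \<open>R\<close> is a nonempty Dumont
  permutation of some \<open>{1..j}\<close>; when \<open>j\<close> is odd, \<open>L\<close> is empty, because its least entry \<open>j + 1\<close> would
  be even and followed by something larger; when \<open>j\<close> is even, \<open>L\<close> is a shifted Dumont permutation of
  odd length.  Hence \<open>A\<^sub>k = 1 + x B\<^sub>k + x B\<^sub>k\<^sub>-\<^sub>1 (A\<^sub>k - 1)\<close>, which becomes the recurrence for \<open>F\<^sub>k\<close>.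
\<close>

section \<open>The Dumont condition around the maximum\<close>

definition dumont_step :: "nat \<Rightarrow> nat \<Rightarrow> bool" where
  "dumont_step x y \<longleftrightarrow> (if even x then y < x else x < y)"

text \<open>Replaces indices by adjacent pairs, so that the condition splits over \<open>@\<close>.
  The last entry must be odd because an even one needs a successor.\<close>

lemma dumont_iff_successively:
  "dumont p \<longleftrightarrow> successively dumont_step p \<and> (p \<noteq> [] \<longrightarrow> odd (last p))"
proof (cases "p = []")
  case True
  then show ?thesis by (simp add: dumont_def)
next
  case False
  then obtain m where m: "length p = Suc m" by (cases p) auto
  have l: "last p = p ! m" using False m by (simp add: last_conv_nth)
  show ?thesis
    using False unfolding dumont_def successively_conv_nth dumont_step_def m l
    by (simp add: All_less_Suc) auto
qed

lemma dumont_Nil [simp]: "dumont []"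
  by (simp add: dumont_def)

text \<open>An odd entry wants a larger successor, which the maximum cannot have, so it comes last.
  The last entry of \<open>L\<close> then ascends to \<open>n\<close>, hence is odd, which is
  exactly what \<open>dumont L\<close> demands at its end.\<close>

lemma dumont_append_odd_max:
  assumes "odd n" "\<forall>x\<in>set L. x < n" "\<forall>x\<in>set R. x < n"
  shows "dumont (L @ n # R) \<longleftrightarrow> R = [] \<and> dumont L"
proof (cases R)
  case Nil
  moreover have "L \<noteq> [] \<Longrightarrow> last L < n" using assms by simp
  ultimately show ?thesis
    using assms(1,3) by (cases "L = []") (auto simp: dumont_iff_successively successively_append_iff dumont_step_def)
next
  case (Cons r R')
  then show ?thesis
    using assms by (auto simp: dumont_iff_successively successively_append_iff dumont_step_def)
qed

text \<open>Here the maximum needs a successor, and any successor is smaller. Both parts therefore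
  decouple: \<open>L\<close> ends in an ascent to \<open>n\<close>, so its last entry is
  odd.\<close>

lemma dumont_append_even_max:
  assumes "even n" "\<forall>x\<in>set L. x < n" "\<forall>x\<in>set R. x < n"
  shows "dumont (L @ n # R) \<longleftrightarrow> R \<noteq> [] \<and> dumont R \<and> dumont L"
proof (cases R)
  case Nil
  then show ?thesis using assms by (auto simp: dumont_iff_successively)
next
  case (Cons r R')
  moreover have "L \<noteq> [] \<Longrightarrow> last L < n" using assms by simp
  ultimately show ?thesis
    using assms(1,3) by (cases "L = []")
      (auto simp: dumont_iff_successively successively_append_iff dumont_step_def)
qed

text \<open>An even shift preserves both parity and order.\<close>

lemma dumont_shift_even:
  assumes "even j"
  shows "dumont (map (\<lambda>x. x + j) L) \<longleftrightarrow> dumont L"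
  using assms by (auto simp: dumont_iff_successively successively_map dumont_step_def last_map)

lemma dumont_even_not_least:
  assumes "dumont p" "x \<in> set p" "even x"
  shows "\<exists>y\<in>set p. y < x"
proof -
  obtain i where i: "i < length p" "x = p ! i" using assms(2) by (metis in_set_conv_nth)
  with assms(1,3) have "Suc i < length p" "p ! Suc i < x" unfolding dumont_def by auto
  then show ?thesis by auto
qed

section \<open>Pattern avoidance around the maximum\<close>

lemma subseq_imp_set_subset: "subseq xs ys \<Longrightarrow> set xs \<subseteq> set ys"
  by (auto elim: list_emb_set)

lemma avoids_132_iff:
  "avoids p [1, 3, 2] \<longleftrightarrow> (\<forall>a b c. subseq [a, b, c] p \<longrightarrow> \<not> (a < c \<and> c < b))"
proof -
  have *: "order_isomorphic s [1, 3, 2] \<longleftrightarrow> (\<exists>a b c. s = [a, b, c] \<and> a < c \<and> c < b)" for s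
  proof
    assume s: "order_isomorphic s [1, 3, 2]"
    then obtain a b c where abc: "s = [a, b, c]"
      by (auto simp: order_isomorphic_def numeral_3_eq_3 length_Suc_conv)
    with s have "a < c \<and> c < b"
      by (auto simp: order_isomorphic_def All_less_Suc numeral_2_eq_2)
    with abc show "\<exists>a b c. s = [a, b, c] \<and> a < c \<and> c < b" by blast
  qed (auto simp: order_isomorphic_def less_Suc_eq nth_Cons')
  show ?thesis unfolding avoids_def * by blast
qed

lemma avoids_132D: "avoids p [1, 3, 2] \<Longrightarrow> subseq [a, b, c] p \<Longrightarrow> a < c \<Longrightarrow> \<not> c < b"
  unfolding avoids_132_iff by blast

text \<open>Being order-isomorphic to \<open>12...k\<close> means being strictly increasing of
  length exactly \<open>k\<close>. For \<open>k = 0\<close> the empty subsequence already violates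
  this.\<close>

lemma avoids_increasing_iff:
  "avoids p (increasing_pattern k) \<longleftrightarrow> (\<forall>s. subseq s p \<and> sorted_wrt (<) s \<longrightarrow> length s \<noteq> k)"
proof -
  have *: "order_isomorphic s (increasing_pattern k) \<longleftrightarrow> sorted_wrt (<) s \<and> length s = k" for s
  proof
    assume s: "order_isomorphic s (increasing_pattern k)"
    then have l: "length s = k"
      by (simp add: order_isomorphic_def increasing_pattern_def)
    moreover have "s ! i < s ! j" if "i < j" "j < k" for i j
      using s that l by (auto simp: order_isomorphic_def increasing_pattern_def simp del: upt_Suc)
    ultimately show "sorted_wrt (<) s \<and> length s = k"
      by (simp add: sorted_wrt_iff_nth_less)
  next
    assume s: "sorted_wrt (<) s \<and> length s = k"
    then have "s ! i < s ! j \<longleftrightarrow> i < j" if "i < k" "j < k" for i j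
      using that by (metis sorted_wrt_iff_nth_less less_asym linorder_less_linear)
    with s show "order_isomorphic s (increasing_pattern k)"
      by (auto simp: order_isomorphic_def increasing_pattern_def simp del: upt_Suc)
  qed
  show ?thesis unfolding avoids_def * by blast
qed

lemma avoids_Nil [simp]: "avoids [] t \<longleftrightarrow> t \<noteq> []"
  by (auto simp: avoids_def order_isomorphic_def)

lemma avoids_subseq: "avoids p t \<Longrightarrow> subseq q p \<Longrightarrow> avoids q t"
  unfolding avoids_def using subseq_order.order_trans by blast

lemma avoids_map_mono:
  assumes "strict_mono f"
  shows "avoids (map f p) t \<longleftrightarrow> avoids p t"
proof -
  have *: "order_isomorphic (map f s) t \<longleftrightarrow> order_isomorphic s t" for s
    using strict_mono_less[OF assms] by (auto simp: order_isomorphic_def)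
  have "subseq s (map f p) \<longleftrightarrow> (\<exists>s'. s = map f s' \<and> subseq s' p)" for s
  proof
    assume "subseq s (map f p)"
    then obtain N where "s = nths (map f p) N" by (auto simp: subseq_conv_nths)
    then show "\<exists>s'. s = map f s' \<and> subseq s' p"
      by (auto simp: subseq_conv_nths nths_map)
  qed (auto intro: subseq_map)
  then show ?thesis unfolding avoids_def using * by metis
qed

text \<open>With \<open>L\<close> above \<open>R\<close>, an occurrence \<open>a b c\<close> of 132
  cannot start in \<open>L\<close> and end in \<open>R\<close>, since \<open>a < c\<close>. If it
  used \<open>n\<close>, then \<open>n\<close> would be \<open>b\<close>, which forces precisely
  such a start and end.\<close>

lemma avoids_132_append_max:
  assumes "\<forall>x\<in>set L. \<forall>y\<in>set R. y < x" "\<forall>x\<in>set L. x < n" "\<forall>x\<in>set R. x < n"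
  shows "avoids (L @ n # R) [1, 3, 2] \<longleftrightarrow> avoids L [1, 3, 2] \<and> avoids R [1, 3, 2]"
proof
  assume av: "avoids (L @ n # R) [1, 3, 2]"
  show "avoids L [1, 3, 2] \<and> avoids R [1, 3, 2]"
    using avoids_subseq[OF av, of L] avoids_subseq[OF av, of R]
    by (simp add: list_emb_append2 subseq_rev_drop_many subseq_Cons')
next
  assume av: "avoids L [1, 3, 2] \<and> avoids R [1, 3, 2]"
  show "avoids (L @ n # R) [1, 3, 2]"
    unfolding avoids_132_iff
  proof (intro allI impI notI)
    fix a b c
    assume sub: "subseq [a, b, c] (L @ n # R)" and abc: "a < c \<and> c < b"
    from sub obtain s1 s2 where s: "[a, b, c] = s1 @ s2" "subseq s1 L" "subseq s2 (n # R)"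
      by (auto elim: subseq_appendE)
    have s1: "set s1 \<subseteq> set L" and s2: "set s2 \<subseteq> insert n (set R)"
      using subseq_imp_set_subset[OF s(2)] subseq_imp_set_subset[OF s(3)] by auto
    consider "s1 = []" "s2 = [a, b, c]" | "s1 = [a]" "s2 = [b, c]" | "s1 = [a, b]" "s2 = [c]"
      | "s1 = [a, b, c]"
      using s(1)[symmetric] unfolding append_eq_Cons_conv by blast
    then show False
    proof cases
      case 1
      \<comment> \<open>If \<open>a\<close> were \<open>n\<close>, no later entry could exceed it;
        hence the whole occurrence lies in \<open>R\<close>.\<close>
      then have "c < n \<or> b < n" using s2 abc assms by auto
      with 1 have "a \<noteq> n" using s2 abc assms by auto
      with 1 s have "subseq [a, b, c] R" by auto
      with av abc show False using avoids_132D by blast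
    next
      case 2
      with s1 s2 assms abc have "c \<noteq> n" by force
      with 2 s1 s2 assms abc show False by force
    next
      case 3
      with s1 s2 assms abc show False by force
    next
      case 4
      with s av abc show False using avoids_132D by blast
    qed
  qed
qed

text \<open>Otherwise \<open>x\<close>, \<open>n\<close>, \<open>y\<close> would form a 132.\<close>

lemma avoids_132_append_max_greater:
  assumes "avoids (L @ n # R) [1, 3, 2]" "distinct (L @ n # R)" "\<forall>x\<in>set R. x < n"
    "x \<in> set L" "y \<in> set R"
  shows "y < x"
proof (rule ccontr)
  assume "\<not> y < x"
  with assms have "x < y" "y < n" by (auto simp: order.order_iff_strict not_less)
  moreover have "subseq ([x] @ n # [y]) (L @ n # R)"
    using assms by (intro list_emb_append_mono) (auto simp: subseq_singleton_left)
  ultimately show False using avoids_132D[OF assms(1)] by simp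
qed

text \<open>Appending \<open>n\<close> lengthens every increasing subsequence of \<open>L\<close> by
  one, so the bound for \<open>L\<close> drops to \<open>k\<close>. Nothing increasing passes from
  \<open>L\<close> or from \<open>n\<close> into \<open>R\<close>.\<close>

lemma avoids_increasing_append_max:
  assumes "\<forall>x\<in>set L. \<forall>y\<in>set R. y < x" "\<forall>x\<in>set L. x < n" "\<forall>x\<in>set R. x < n"
  shows "avoids (L @ n # R) (increasing_pattern (Suc k)) \<longleftrightarrow>
    avoids L (increasing_pattern k) \<and> avoids R (increasing_pattern (Suc k))"
proof
  assume av: "avoids (L @ n # R) (increasing_pattern (Suc k))"
  have "avoids R (increasing_pattern (Suc k))"
    using avoids_subseq[OF av, of R] by (simp add: list_emb_append2 subseq_Cons')
  moreover have "length s \<noteq> k" if s: "subseq s L" "sorted_wrt (<) s" for s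
  proof -
    have "subseq (s @ n # []) (L @ n # R)"
      using s by (intro list_emb_append_mono) auto
    moreover have "sorted_wrt (<) (s @ [n])"
      using s assms(2) subseq_imp_set_subset[OF s(1)] by (auto simp: sorted_wrt_append)
    ultimately show ?thesis using av unfolding avoids_increasing_iff by force
  qed
  ultimately show "avoids L (increasing_pattern k) \<and> avoids R (increasing_pattern (Suc k))"
    unfolding avoids_increasing_iff[of L] by blast
next
  assume av: "avoids L (increasing_pattern k) \<and> avoids R (increasing_pattern (Suc k))"
  show "avoids (L @ n # R) (increasing_pattern (Suc k))"
    unfolding avoids_increasing_iff
  proof (intro allI impI notI)
    fix s
    assume sub: "subseq s (L @ n # R) \<and> sorted_wrt (<) s" and len: "length s = Suc k"
    then obtain s1 s2 where s: "s = s1 @ s2" "subseq s1 L" "subseq s2 (n # R)"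
      by (auto elim: subseq_appendE)
    have s1: "set s1 \<subseteq> set L" and s2: "set s2 \<subseteq> insert n (set R)"
      using subseq_imp_set_subset[OF s(2)] subseq_imp_set_subset[OF s(3)] by auto
    have sort: "sorted_wrt (<) s1" "sorted_wrt (<) s2" "\<forall>x\<in>set s1. \<forall>y\<in>set s2. x < y"
      using sub s(1) by (auto simp: sorted_wrt_append)
    show False
    proof (cases "s2 = [] \<or> s2 = [n]")
      case True
      then have "length s1 = Suc k \<or> length s1 = k" using len s(1) by auto
      moreover have "length s1 \<noteq> k" using av s(2) sort by (auto simp: avoids_increasing_iff)
      \<comment> \<open>Avoidance excludes only the exact length \<open>k\<close>, so a longer
        subsequence has to be truncated first.\<close>
      moreover have "length s1 \<noteq> Suc k"
      proof
        assume l: "length s1 = Suc k"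
        have "subseq (take k s1) L"
          using s(2) by (meson prefix_imp_subseq subseq_order.order_trans take_is_prefix)
        with l av sort show False
          by (auto simp: avoids_increasing_iff sorted_wrt_take)
      qed
      ultimately show False by blast
    next
      case False
      then obtain y s3 where y: "s2 = y # s3" by (cases s2) auto
      have "y \<noteq> n"
      proof
        assume "y = n"
        with y False obtain z s4 where "s3 = z # s4" by (cases s3) auto
        with y s2 sort(2) assms(3) \<open>y = n\<close> show False by force
      qed
      with y s(3) s2 have "y \<in> set R" "subseq s2 R" by auto
      \<comment> \<open>An entry of \<open>s1\<close> lies in \<open>L\<close> and so exceeds
        \<open>y\<close>, although it precedes \<open>y\<close> in an increasing list.\<close>
      moreover from this(1) have "s1 = []"
        using y s1 sort(3) assms(1) by (cases s1) (force simp: not_less_iff_gr_or_eq)+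
      ultimately show False
        using s(1) len sort av by (auto simp: avoids_increasing_iff)
    qed
  qed
qed

section \<open>Decomposing the avoiders by the position of the maximum\<close>

abbreviation increasing_avoiders :: "nat \<Rightarrow> nat \<Rightarrow> nat list set" where
  "increasing_avoiders k n \<equiv> dumont_avoiders (increasing_pattern k) n"

lemma mem_dumont_avoiders_iff:
  "p \<in> dumont_avoiders t n \<longleftrightarrow>
    distinct p \<and> set p = {1..n} \<and> dumont p \<and> avoids p [1, 3, 2] \<and> avoids p t"
  by (auto simp: dumont_avoiders_def permutations_of_set_def)

lemma length_dumont_avoiders:
  assumes "p \<in> dumont_avoiders t n"
  shows "length p = n"
  using assms distinct_card[of p] by (simp add: mem_dumont_avoiders_iff)

lemma finite_dumont_avoiders: "finite (dumont_avoiders t n)"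
  by (simp add: dumont_avoiders_def)

lemma increasing_avoiders_0_left: "increasing_avoiders 0 n = {}"
proof -
  have "\<not> avoids p (increasing_pattern 0)" for p
    unfolding avoids_def increasing_pattern_def by (auto simp: order_isomorphic_def)
  then show ?thesis by (simp add: dumont_avoiders_def)
qed

lemma increasing_avoiders_0_right: "increasing_avoiders (Suc k) 0 = {[]}"
  by (auto simp: mem_dumont_avoiders_iff increasing_pattern_def simp del: upt_Suc)

lemma dumont_avoiders_split:
  assumes "p \<in> dumont_avoiders t (Suc m)"
  obtains L R where "p = L @ Suc m # R" "\<forall>x\<in>set L. \<forall>y\<in>set R. y < x"
    "\<forall>x\<in>set L. x < Suc m" "\<forall>x\<in>set R. x < Suc m"
    "set L \<union> set R = {1..m}" "distinct L" "distinct R"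
proof -
  note p = assms[unfolded mem_dumont_avoiders_iff]
  then have "Suc m \<in> set p" by auto
  then obtain L R where LR: "p = L @ Suc m # R" by (meson split_list)
  have U: "set L \<union> set R = {1..m}"
  proof -
    have "set L \<union> set R = set p - {Suc m}" using p LR by auto
    also have "set p = {1..Suc m}" using p by blast
    also have "{1..Suc m} - {Suc m} = {1..m}" by auto
    finally show ?thesis .
  qed
  have "x < Suc m" if "x \<in> set L \<union> set R" for x using that unfolding U by simp
  then have less: "\<forall>x\<in>set L. x < Suc m" "\<forall>x\<in>set R. x < Suc m" by auto
  have "\<forall>x\<in>set L. \<forall>y\<in>set R. y < x"
    using avoids_132_append_max_greater[of L "Suc m" R] p less LR by blast
  with LR U less p that show thesis by auto
qed

lemma increasing_avoiders_odd:
  assumes "even m"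
  shows "increasing_avoiders (Suc k) (Suc m) = (\<lambda>L. L @ [Suc m]) ` increasing_avoiders k m"
proof (intro equalityI subsetI)
  fix p assume p: "p \<in> increasing_avoiders (Suc k) (Suc m)"
  obtain L R where LR: "p = L @ Suc m # R" "\<forall>x\<in>set L. \<forall>y\<in>set R. y < x"
    "\<forall>x\<in>set L. x < Suc m" "\<forall>x\<in>set R. x < Suc m"
    "set L \<union> set R = {1..m}" "distinct L" "distinct R"
    using dumont_avoiders_split[OF p] by blast
  have "odd (Suc m)" using assms by simp
  note iffs = dumont_append_odd_max[OF this LR(3,4)] avoids_132_append_max[OF LR(2-4)]
    avoids_increasing_append_max[OF LR(2-4)]
  have "R = []" "L \<in> increasing_avoiders k m"
    using p LR(5,6) unfolding mem_dumont_avoiders_iff LR(1) iffs by auto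
  with LR(1) show "p \<in> (\<lambda>L. L @ [Suc m]) ` increasing_avoiders k m" by simp
next
  fix p assume "p \<in> (\<lambda>L. L @ [Suc m]) ` increasing_avoiders k m"
  then obtain L where p: "p = L @ [Suc m]" and L: "L \<in> increasing_avoiders k m" by auto
  have side: "\<forall>x\<in>set L. \<forall>y\<in>set []. y < x" "\<forall>x\<in>set L. x < Suc m" "\<forall>x\<in>set []. x < Suc m"
    using L by (auto simp: mem_dumont_avoiders_iff)
  have "odd (Suc m)" using assms by simp
  note iffs = dumont_append_odd_max[OF this side(2,3)] avoids_132_append_max[OF side]
    avoids_increasing_append_max[OF side]
  show "p \<in> increasing_avoiders (Suc k) (Suc m)"
    using L unfolding mem_dumont_avoiders_iff p iffs
    by (auto simp: increasing_pattern_def simp del: upt_Suc)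
qed

text \<open>Inverse of the splitting at the maximum \<open>Suc m\<close>: \<open>R\<close> is meant
  to fill \<open>{1..j}\<close>, and \<open>L\<close>, given as a permutation of
  \<open>{1..m - j}\<close>, is lifted above it.\<close>

definition glue :: "nat \<Rightarrow> nat \<Rightarrow> nat list \<times> nat list \<Rightarrow> nat list" where
  "glue m j = (\<lambda>(L, R). map (\<lambda>x. x + j) L @ Suc m # R)"

lemma strict_mono_add_right: "strict_mono (\<lambda>x::nat. x + j)"
  by (simp add: strict_mono_def)

text \<open>The index \<open>j\<close> is the length of \<open>R\<close>, positive because the even
  maximum needs a successor. An odd \<open>j\<close> survives only as \<open>j = m\<close>, where
  \<open>L\<close> is empty.\<close>

lemma increasing_avoiders_even:
  assumes "odd m"
  shows "increasing_avoiders (Suc k) (Suc m) =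
    (\<Union>j\<in>{j\<in>{1..m}. even j \<or> j = m}.
      glue m j ` (increasing_avoiders k (m - j) \<times> increasing_avoiders (Suc k) j))"
proof (intro equalityI subsetI)
  fix p assume p: "p \<in> increasing_avoiders (Suc k) (Suc m)"
  obtain L R where LR: "p = L @ Suc m # R" "\<forall>x\<in>set L. \<forall>y\<in>set R. y < x"
    "\<forall>x\<in>set L. x < Suc m" "\<forall>x\<in>set R. x < Suc m"
    "set L \<union> set R = {1..m}" "distinct L" "distinct R"
    using dumont_avoiders_split[OF p] by blast
  have "even (Suc m)" using assms by simp
  note iffs = dumont_append_even_max[OF this LR(3,4)] avoids_132_append_max[OF LR(2-4)]
    avoids_increasing_append_max[OF LR(2-4)]
  have props: "R \<noteq> []" "dumont R" "dumont L" "avoids L [1, 3, 2]" "avoids R [1, 3, 2]"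
    "avoids L (increasing_pattern k)" "avoids R (increasing_pattern (Suc k))"
    using p unfolding mem_dumont_avoiders_iff LR(1) iffs by auto
  \<comment> \<open>Since \<open>R\<close> lies below \<open>L\<close> and together they fill
    \<open>{1..m}\<close>, the maximum of \<open>R\<close> determines both value sets.\<close>
  define j where "j = Max (set R)"
  have j: "j \<in> set R" "\<forall>y\<in>set R. y \<le> j" using props(1) by (auto simp: j_def)
  with LR(5) have j_bounds: "1 \<le> j" "j \<le> m" by auto
  have "x \<notin> set L" if "x \<le> j" for x using that j LR(2) leD by blast
  moreover have "x \<in> set L \<union> set R" if "1 \<le> x" "x \<le> j" for x
    using that j_bounds LR(5) by simp
  ultimately have "{1..j} \<subseteq> set R" by auto
  with j(2) LR(5) have R: "set R = {1..j}" by auto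
  have L: "set L = {Suc j..m}"
  proof -
    have "set L \<inter> set R = {}" using LR(2) by blast
    with LR(5) R have "set L = {1..m} - {1..j}" by blast
    also have "\<dots> = {Suc j..m}" by auto
    finally show ?thesis .
  qed
  define L' where "L' = map (\<lambda>x. x - j) L"
  have "map (\<lambda>x. x + j) L' = L"
    unfolding L'_def map_map by (rule map_idI) (use L in auto)
  note L_eq = this[symmetric]
  have setL': "set L' = {1..m - j}"
  proof -
    have "(\<lambda>x. x + j) ` set L' = (\<lambda>x. x + j) ` {1..m - j}"
      using L j_bounds unfolding L_eq set_map by simp
    then show ?thesis by (rule inj_image_eq_iff[THEN iffD1, rotated]) (simp add: inj_def)
  qed
  have j_cases: "even j \<or> j = m"
  proof (rule ccontr)
    assume "\<not> ?thesis"
    \<comment> \<open>The least entry \<open>Suc j\<close> of \<open>L\<close> is even and lacks a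
      smaller successor.\<close>
    then have "odd j" "Suc j \<in> set L" using L j_bounds by auto
    then show False using dumont_even_not_least[OF props(3), of "Suc j"] L by auto
  qed
  \<comment> \<open>Shifting down preserves parity only for even \<open>j\<close>; for odd
    \<open>j\<close> the list is empty.\<close>
  have "dumont L'"
  proof (cases "even j")
    case True
    then show ?thesis using props(3) dumont_shift_even L_eq by metis
  next
    case False
    then show ?thesis using j_cases setL' by simp
  qed
  then have "L' \<in> increasing_avoiders k (m - j)"
    using LR(6) props setL' avoids_map_mono[OF strict_mono_add_right]
    by (auto simp: mem_dumont_avoiders_iff L_eq distinct_map)
  moreover have "R \<in> increasing_avoiders (Suc k) j"
    using LR(7) props R by (auto simp: mem_dumont_avoiders_iff)
  moreover have "p = glue m j (L', R)" using LR(1) L_eq by (simp add: glue_def)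
  ultimately show "p \<in> (\<Union>j\<in>{j\<in>{1..m}. even j \<or> j = m}.
      glue m j ` (increasing_avoiders k (m - j) \<times> increasing_avoiders (Suc k) j))"
    using j_cases j_bounds by auto
next
  fix p assume "p \<in> (\<Union>j\<in>{j\<in>{1..m}. even j \<or> j = m}.
      glue m j ` (increasing_avoiders k (m - j) \<times> increasing_avoiders (Suc k) j))"
  then obtain j L' R where j: "1 \<le> j" "j \<le> m" "even j \<or> j = m"
    and L': "L' \<in> increasing_avoiders k (m - j)" and R: "R \<in> increasing_avoiders (Suc k) j"
    and p: "p = map (\<lambda>x. x + j) L' @ Suc m # R"
    by (auto simp: glue_def)
  define L where "L = map (\<lambda>x. x + j) L'"
  have setL: "set L = {Suc j..m}"
    using L' j by (simp add: L_def mem_dumont_avoiders_iff)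
  have setR: "set R = {1..j}" using R by (simp add: mem_dumont_avoiders_iff)
  have side: "\<forall>x\<in>set L. \<forall>y\<in>set R. y < x" "\<forall>x\<in>set L. x < Suc m" "\<forall>x\<in>set R. x < Suc m"
    using setL setR j by auto
  have "even (Suc m)" using assms by simp
  note iffs = dumont_append_even_max[OF this side(2,3)] avoids_132_append_max[OF side]
    avoids_increasing_append_max[OF side]
  have "dumont L"
  proof (cases "even j")
    case True
    then show ?thesis using L' dumont_shift_even by (simp add: L_def mem_dumont_avoiders_iff)
  next
    case False
    then show ?thesis using j setL by simp
  qed
  moreover have "distinct L" "avoids L [1, 3, 2]" "avoids L (increasing_pattern k)"
    using L' avoids_map_mono[OF strict_mono_add_right]
    by (auto simp: L_def mem_dumont_avoiders_iff distinct_map)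
  moreover have "R \<noteq> []" using setR j by auto
  moreover have "set (L @ Suc m # R) = {1..Suc m}" using setL setR j by auto
  moreover have "distinct R" "dumont R" "avoids R [1, 3, 2]" "avoids R (increasing_pattern (Suc k))"
    using R by (auto simp: mem_dumont_avoiders_iff)
  moreover have "distinct (L @ Suc m # R)"
    using \<open>distinct L\<close> \<open>distinct R\<close> setL setR j by auto
  ultimately show "p \<in> increasing_avoiders (Suc k) (Suc m)"
    unfolding mem_dumont_avoiders_iff p L_def[symmetric] iffs by blast
qed

section \<open>Recurrences for the counts\<close>

abbreviation avoider_count :: "nat \<Rightarrow> nat \<Rightarrow> nat" where
  "avoider_count k n \<equiv> card (increasing_avoiders k n)"

lemma avoider_count_odd:
  assumes "even m"
  shows "avoider_count (Suc k) (Suc m) = avoider_count k m"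
  unfolding increasing_avoiders_odd[OF assms] by (rule card_image) (simp add: inj_on_def)

lemma avoider_count_even_sum:
  assumes "odd m"
  shows "avoider_count (Suc k) (Suc m) =
    (\<Sum>j | j \<in> {1..m} \<and> (even j \<or> j = m). avoider_count k (m - j) * avoider_count (Suc k) j)"
proof -
  let ?J = "{j\<in>{1..m}. even j \<or> j = m}"
  let ?P = "\<lambda>j. increasing_avoiders k (m - j) \<times> increasing_avoiders (Suc k) j"
  \<comment> \<open>This yields at once the injectivity of each \<open>glue m j\<close> and the
    disjointness of the images: \<open>Suc m\<close> marks the cut, and the length of
    \<open>R\<close> recovers \<open>j\<close>.\<close>
  have *: "L = L' \<and> R = R' \<and> i = j"
    if "i \<in> ?J" "j \<in> ?J" "(L, R) \<in> ?P i" "(L', R') \<in> ?P j" "glue m i (L, R) = glue m j (L', R')"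
    for i j L R L' R'
  proof -
    have "Suc m \<notin> set (map (\<lambda>x. x + i) L)" "Suc m \<notin> set R"
      "Suc m \<notin> set (map (\<lambda>x. x + j) L')" "Suc m \<notin> set R'"
      using that by (auto simp: mem_dumont_avoiders_iff)
    then have eq: "map (\<lambda>x. x + i) L = map (\<lambda>x. x + j) L'" "R = R'"
      using that(5) by (auto simp: glue_def append_Cons_eq_iff)
    then have "i = j" using that(3,4) by (auto dest!: length_dumont_avoiders)
    with eq show ?thesis by (auto simp: inj_map_eq_map inj_def)
  qed
  have "card (\<Union>j\<in>?J. glue m j ` ?P j) = (\<Sum>j\<in>?J. card (glue m j ` ?P j))"
  proof (rule card_UN_disjoint)
    show "\<forall>i\<in>?J. \<forall>j\<in>?J. i \<noteq> j \<longrightarrow> glue m i ` ?P i \<inter> glue m j ` ?P j = {}"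
      using * by blast
  qed (auto simp: finite_dumont_avoiders)
  also have "\<dots> = (\<Sum>j\<in>?J. card (?P j))"
  proof (rule sum.cong[OF refl], rule card_image)
    fix j assume "j \<in> ?J"
    then show "inj_on (glue m j) (?P j)" using * by (intro inj_onI) blast
  qed
  finally show ?thesis
    unfolding increasing_avoiders_even[OF assms] by (simp add: card_cartesian_product)
qed

text \<open>The term \<open>j = Suc n\<close> has empty \<open>L\<close> and an \<open>R\<close> of
  odd length; the other terms have even \<open>j\<close> and an \<open>L\<close> of odd length.
  \<open>avoider_count_odd\<close> lowers the odd length in each case, so only even lengths
  remain.\<close>

lemma avoider_count_even:
  assumes "even n"
  shows "avoider_count (Suc (Suc k)) (Suc (Suc n)) = avoider_count (Suc k) n +
    (\<Sum>j | j \<in> {1..n} \<and> even j. avoider_count k (n - j) * avoider_count (Suc (Suc k)) j)"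
proof -
  have "{j. j \<in> {1..Suc n} \<and> (even j \<or> j = Suc n)} = insert (Suc n) {j. j \<in> {1..n} \<and> even j}"
    by auto
  moreover have "avoider_count (Suc k) (Suc n - j) = avoider_count k (n - j)"
    if "j \<in> {1..n} \<and> even j" for j
    using that assms avoider_count_odd[of "n - j" k] by (simp add: Suc_diff_le)
  ultimately show ?thesis
    using assms avoider_count_even_sum[of "Suc n" "Suc k"]
    by (simp add: avoider_count_odd increasing_avoiders_0_right)
qed

section \<open>Generating functions\<close>

unbundle fps_syntax

text \<open>The even part of the generating function, which is \<open>A k\<close>, given directly by
  its coefficients.\<close>

definition even_gf :: "nat \<Rightarrow> rat fps" where
  "even_gf k = Abs_fps (\<lambda>n. if even n then of_nat (avoider_count k n) else 0)"

lemma even_gf_nth: "even_gf k $ n = (if even n then of_nat (avoider_count k n) else 0)"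
  by (simp add: even_gf_def)

lemma even_gf_0: "even_gf 0 = 0"
  by (simp add: fps_eq_iff even_gf_nth increasing_avoiders_0_left)

lemma increasing_avoiders_1:
  assumes "n > 0"
  shows "increasing_avoiders (Suc 0) n = {}"
proof (rule equals0I)
  fix p assume "p \<in> increasing_avoiders (Suc 0) n"
  then have p: "set p = {1..n}" and av: "avoids p (increasing_pattern (Suc 0))"
    by (simp_all add: mem_dumont_avoiders_iff)
  have "subseq [n] p" using p assms by (simp add: subseq_singleton_left)
  moreover have "sorted_wrt (<) [n]" "length [n] = Suc 0" by simp_all
  ultimately show False using av unfolding avoids_increasing_iff by blast
qed

lemma even_gf_1: "even_gf (Suc 0) = 1"
  by (simp add: fps_eq_iff even_gf_nth increasing_avoiders_1 increasing_avoiders_0_right)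

text \<open>Subtracting 1 removes the constant coefficient, because the sum in
  \<open>avoider_count_even\<close> starts at \<open>j = 1\<close>.\<close>

lemma even_gf_recurrence:
  "even_gf (Suc (Suc k)) =
    1 + fps_X\<^sup>2 * (even_gf (Suc k) + even_gf k * (even_gf (Suc (Suc k)) - 1))"
proof (rule fps_ext)
  fix n
  let ?E = even_gf and ?k = "Suc (Suc k)"
  show "?E ?k $ n = (1 + fps_X\<^sup>2 * (?E (Suc k) + ?E k * (?E ?k - 1))) $ n"
  proof (cases "n < 2")
    case True
    then have "n = 0 \<or> n = 1" by auto
    then show ?thesis
      by (auto simp: even_gf_nth fps_X_power_mult_nth increasing_avoiders_0_right)
  next
    case False
    then obtain m where n: "n = Suc (Suc m)" by (metis add_2_eq_Suc le_Suc_ex not_less)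
    \<comment> \<open>The product is commuted so that \<open>j\<close> indexes the factor for
      \<open>R\<close>, as in the count recurrence.\<close>
    have conv: "(?E k * (?E ?k - 1)) $ m =
      (\<Sum>j=0..m. (?E ?k - 1) $ j * ?E k $ (m - j))"
      by (simp only: mult.commute[of "?E k"] fps_mult_nth)
    have "\<dots> = (if even m then of_nat (\<Sum>j | j \<in> {1..m} \<and> even j.
        avoider_count k (m - j) * avoider_count ?k j) else 0)"
    proof (cases "even m")
      case True
      have "(\<Sum>j=0..m. (?E ?k - 1) $ j * ?E k $ (m - j)) =
        (\<Sum>j | j \<in> {1..m} \<and> even j. (?E ?k - 1) $ j * ?E k $ (m - j))"
        by (rule sum.mono_neutral_right)
          (auto simp: even_gf_nth increasing_avoiders_0_right Suc_le_eq)
      also have "\<dots> = (\<Sum>j | j \<in> {1..m} \<and> even j.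
        of_nat (avoider_count k (m - j) * avoider_count ?k j))"
        using True by (intro sum.cong) (auto simp: even_gf_nth)
      finally show ?thesis using True by simp
    next
      case False
      \<comment> \<open>For odd \<open>m\<close>, one of \<open>j\<close> and \<open>m - j\<close>
        is odd, so every term vanishes.\<close>
      then show ?thesis
        by (auto intro!: sum.neutral simp: even_gf_nth increasing_avoiders_0_right)
    qed
    with conv show ?thesis
      by (simp add: n even_gf_nth fps_X_power_mult_nth avoider_count_even)
  qed
qed

text \<open>The recurrence is linear in the newest series. Collecting its terms gives the factor
  \<open>D\<close>, the denominator in the recurrence for \<open>F_nat\<close>, which has constant
  coefficient 1 and can be cancelled.\<close>

lemma even_gf_eq_F_nat: "even_gf k = F_nat k"
proof (induction k rule: F_nat.induct)
  case (3 r)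
  define D where "D = 1 - fps_X\<^sup>2 * F_nat r"
  have D: "D $ 0 \<noteq> 0" by (simp add: D_def fps_X_power_mult_nth)
  define E where "E = even_gf (Suc (Suc r))"
  have "E - (1 + fps_X\<^sup>2 * (F_nat (Suc r) + F_nat r * (E - 1))) = 0"
    using even_gf_recurrence[of r] unfolding 3 E_def by (simp only: right_minus_eq)
  then have "E * D = D + fps_X\<^sup>2 * F_nat (Suc r)"
    by (simp add: D_def algebra_simps)
  also have "\<dots> = F_nat (Suc (Suc r)) * D"
    using D by (simp add: D_def[symmetric] distrib_right fps_divide_unit mult.assoc
        inverse_mult_eq_1)
  finally show ?case using D by (auto simp: E_def)
qed (simp_all add: even_gf_0 even_gf_1)

lemma F_of_nat: "F (int k) = even_gf k"
  by (simp only: F_def even_gf_eq_F_nat nat_int of_nat_less_0_iff if_False)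

text \<open>Even coefficients come from \<open>even_gf\<close>; odd ones are even coefficients for
  the pattern shorter by one, shifted by one degree.\<close>

lemma dumont_gf_increasing:
  "dumont_gf (increasing_pattern k) = F (int k) + fps_X * F (int k - 1)"
proof (cases k)
  case 0
  \<comment> \<open>The empty pattern is never avoided; on the right, \<open>F 0\<close> is zero and
    \<open>F (-1)\<close> is zero by convention.\<close>
  then show ?thesis
    by (simp add: F_def fps_eq_iff dumont_gf_def increasing_avoiders_0_left)
next
  case (Suc l)
  have "dumont_gf (increasing_pattern (Suc l)) = even_gf (Suc l) + fps_X * even_gf l"
  proof (rule fps_ext)
    fix n show "dumont_gf (increasing_pattern (Suc l)) $ n = (even_gf (Suc l) + fps_X * even_gf l) $ n"
      by (cases n) (auto simp: dumont_gf_def even_gf_nth avoider_count_odd)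
  qed
  moreover have "int (Suc l) - 1 = int l" by simp
  ultimately show ?thesis unfolding Suc by (simp only: F_of_nat)
qed

text \<open>Only even exponents occur, so negating the variable changes just the factor
  \<open>fps_X\<close> in the formula for the full series.\<close>

lemma F_even: "F r oo - fps_X = F r"
proof -
  have "even_gf k oo - fps_X = even_gf k" for k
    by (simp add: fps_eq_iff even_gf_nth fps_compose_uminus')
  then show ?thesis by (simp add: F_def even_gf_eq_F_nat)
qed

theorem theorem2p4:
  fixes k :: nat
  shows "A k = F (int k) \<and>
         B k = fps_X * F (int k - 1) \<and>
         dumont_gf (increasing_pattern k) = F (int k) + fps_X * F (int k - 1)"
proof -
  let ?D = "dumont_gf (increasing_pattern k)"
  have neg: "?D oo - fps_X = F (int k) - fps_X * F (int k - 1)"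
    by (simp add: dumont_gf_increasing fps_compose_add_distrib fps_compose_mult_distrib F_even)
  have half: "fps_const (1/2) * (f + f) = f" for f :: "rat fps"
    by (rule fps_ext) (simp only: fps_mult_left_const_nth fps_add_nth, simp)
  have "?D + (?D oo - fps_X) = F (int k) + F (int k)"
    "?D - (?D oo - fps_X) = fps_X * F (int k - 1) + fps_X * F (int k - 1)"
    unfolding neg by (simp_all add: dumont_gf_increasing)
  then have "A k = F (int k)" "B k = fps_X * F (int k - 1)"
    by (simp_all only: A_def B_def half)
  with dumont_gf_increasing show ?thesis by blast
qed

end
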